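(* Let $M>\frac23$ and let $\lambda^*>0$ be the unique positive solution of $(2-3M)\lambda^6+6\lambda^2+4+3M=0$. For $\lambda>0$, the radial deformation gradient $F=\lambda\,\mathbb{1}$ is energetically stable for the Neo-Hooke-Ciarlet-Geymonat energy $W$ with parameter $M$, i.e. $$\langle {\rm D}^2_FW(\lambda\,\mathbb{1}).H,H\rangle\ge0\quad\text{for all }H\in\mathbb{R}^{3\times3},$$ if and only if $1\le\lambda\le\lambda^*$.
   Context: $\mathbb{1}$ is the $3\times3$ identity matrix, $\mathrm{GL}^+(3)$ the group of real $3\times3$ matrices with positive determinant, $\|\cdot\|$ and $\langle X,Y\rangle=\mathrm{tr}(XY^T)$ the Frobenius norm and inner product. For $M>\frac23$, the (one-parameter) Neo-Hooke-Ciarlet-Geymonat energy is $W:\mathrm{GL}^+(3)\to\mathbb{R}$, $$W(F)=\frac12\|F\|^2-\log\det F+\Big(\frac M4-\frac16\Big)\big((\det F)^2-2\log\det F-1\big),$$ and ${\rm D}^2_FW(F)$ denotes its second derivative at $F$, acting as a quadratic form on increments $H\in\mathbb{R}^{3\times3}$. *)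

theory Defs
  imports "HOL-Analysis.Analysis"
begin

(* The Frobenius inner product and norm on 3 x 3 matrices are the library's inner product
   and norm on real^3^3. *)

lemma inner_eq_trace:
  fixes X Y :: "real^3^3"
  shows "X \<bullet> Y = trace (X ** transpose Y)"
  by (simp add: inner_vec_def trace_def matrix_matrix_mult_def transpose_def)

lemma norm_eq_sqrt_trace:
  fixes X :: "real^3^3"
  shows "norm X = sqrt (trace (X ** transpose X))"
  by (simp add: norm_eq_sqrt_inner inner_eq_trace)

(* Meaningful on the open set of matrices with positive determinant; elsewhere the values
   are irrelevant, since only derivatives at points of that set are considered. *)
definition NHCG_energy :: "real \<Rightarrow> real^3^3 \<Rightarrow> real" where
  "NHCG_energy M F =
     1/2 * (norm F)\<^sup>2 - ln (det F)
     + (M/4 - 1/6) * ((det F)\<^sup>2 - 2 * ln (det F) - 1)"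

definition gradient :: "('a::real_inner \<Rightarrow> real) \<Rightarrow> 'a \<Rightarrow> 'a" where
  "gradient f x = (THE D. GDERIV f x :> D)"

(* The second derivative at x as a linear map on increments: the derivative of the gradient
   field, so that inner (second_derivative f x H) H is the associated quadratic form. *)
definition second_derivative :: "('a::real_inner \<Rightarrow> real) \<Rightarrow> 'a \<Rightarrow> 'a \<Rightarrow> 'a" where
  "second_derivative f x = frechet_derivative (gradient f) (at x)"

definition energetically_stable :: "(real^3^3 \<Rightarrow> real) \<Rightarrow> real^3^3 \<Rightarrow> bool" where
  "energetically_stable W F \<longleftrightarrow> (\<forall>H. second_derivative W F H \<bullet> H \<ge> 0)"

definition is_critical_stretch :: "real \<Rightarrow> real \<Rightarrow> bool" where
  "is_critical_stretch M l \<longleftrightarrow>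
     l > 0 \<and> (2 - 3 * M) * l ^ 6 + 6 * l\<^sup>2 + 4 + 3 * M = 0"

definition critical_stretch :: "real \<Rightarrow> real" where
  "critical_stretch M = (THE l. is_critical_stretch M l)"

end

(* With c = M/4 - 1/6, the gradient of the energy is F + g(det F) Cof F for
   g(d) = 2cd - (1 + 2c)/d. Differentiating once more at F = l I gives the quadratic form
   |H|^2 - k <H^T, H> + 4 c l^4 (tr H)^2, where k = 2 c l^4 - (1 + 2c)/l^2.
   Since c > 0, it is nonnegative on all matrices iff |k| <= 1: antisymmetric H yield k >= -1,
   which means l >= 1, while trace-free symmetric H yield k <= 1, which is nonnegativity of the
   polynomial defining the critical stretch. *)

theory Submission imports Defs begin

section \<open>Cofactors and the derivative of the determinant\<close>

text \<open>Unfolding \<open>i+1\<close> and \<open>i+2\<close> over the indices 1, 2, 3 produces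
  the literals 4 and 5, which must be reduced before matrix entries can be matched.\<close>

lemma numeral_4_5_type_3: "(4::3) = 1" "(5::3) = 2"
proof -
  have "(3::3) = 0" by simp
  moreover have "(4::3) = 3 + 1" "(5::3) = 3 + 2" by simp_all
  ultimately show "(4::3) = 1" "(5::3) = 2" by simp_all
qed

text \<open>The polarisation of twice the cofactor matrix. Indices live in the type \<open>3\<close>, where addition
  is modulo 3; the cyclic shifts produce the cofactor signs.\<close>

definition mixed_cofactor :: "real^3^3 \<Rightarrow> real^3^3 \<Rightarrow> real^3^3" where
  "mixed_cofactor F G = (\<chi> i j.
     F$(i+1)$(j+1) * G$(i+2)$(j+2) - F$(i+1)$(j+2) * G$(i+2)$(j+1)
   + G$(i+1)$(j+1) * F$(i+2)$(j+2) - G$(i+1)$(j+2) * F$(i+2)$(j+1))"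

definition cofactor :: "real^3^3 \<Rightarrow> real^3^3" where
  "cofactor F = (1/2) *\<^sub>R mixed_cofactor F F"

lemma bounded_bilinear_mixed_cofactor: "bounded_bilinear mixed_cofactor"
  unfolding bilinear_conv_bounded_bilinear[symmetric] bilinear_def
  by (auto intro!: linearI simp: mixed_cofactor_def vec_eq_iff algebra_simps)

lemma mixed_cofactor_commute: "mixed_cofactor F G = mixed_cofactor G F"
  by (simp add: mixed_cofactor_def vec_eq_iff algebra_simps)

text \<open>With commutativity this makes \<open>F \<bullet> mixed_cofactor G H\<close> a fully
  symmetric trilinear form, the polarisation of the determinant: on the diagonal it is
  \<open>6 * det F\<close>.\<close>

lemma inner_mixed_cofactor_swap:
  "F \<bullet> mixed_cofactor G H = G \<bullet> mixed_cofactor F H"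
  by (simp add: mixed_cofactor_def inner_vec_def sum_3 numeral_4_5_type_3 algebra_simps)

lemma det_eq_inner_cofactor: "det F = (F \<bullet> cofactor F) / 3"
  by (simp add: cofactor_def mixed_cofactor_def inner_vec_def sum_3 det_3 numeral_4_5_type_3
      algebra_simps)

lemma cofactor_scaled_mat_1: "cofactor (l *\<^sub>R mat 1) = l\<^sup>2 *\<^sub>R mat 1"
  by (simp add: cofactor_def mixed_cofactor_def vec_eq_iff forall_3 mat_def numeral_4_5_type_3
      power2_eq_square)

lemma mixed_cofactor_scaled_mat_1:
  "mixed_cofactor (l *\<^sub>R mat 1) H = l *\<^sub>R (trace H *\<^sub>R mat 1 - transpose H)"
  by (simp add: mixed_cofactor_def vec_eq_iff forall_3 mat_def trace_def sum_3 transpose_def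
      numeral_4_5_type_3 algebra_simps)

lemma det_scaled_mat_1: "det (l *\<^sub>R mat 1 :: real^3^3) = l^3"
  by (simp add: det_3 mat_def power3_eq_cube)

lemma cofactor_has_derivative:
  "(cofactor has_derivative mixed_cofactor F) (at F)"
proof -
  have "((\<lambda>F. (1/2) *\<^sub>R mixed_cofactor F F) has_derivative
      (\<lambda>H. (1/2) *\<^sub>R (mixed_cofactor F H + mixed_cofactor H F))) (at F)"
    by (intro derivative_intros bounded_bilinear.FDERIV[OF bounded_bilinear_mixed_cofactor])
  moreover have "(\<lambda>H. (1/2) *\<^sub>R (mixed_cofactor F H + mixed_cofactor H F)) = mixed_cofactor F"
    by (simp add: fun_eq_iff mixed_cofactor_commute[of _ F] flip: scaleR_2)
  ultimately show ?thesis
    by (simp add: cofactor_def[abs_def])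
qed

lemma det_has_derivative:
  "(det has_derivative (\<lambda>H. H \<bullet> cofactor F)) (at F)"
proof -
  have "((\<lambda>F. (F \<bullet> cofactor F) / 3) has_derivative
      (\<lambda>H. (F \<bullet> mixed_cofactor F H + H \<bullet> cofactor F) / 3)) (at F)"
    by (auto intro!: derivative_eq_intros cofactor_has_derivative)
  \<comment> \<open>Symmetry moves \<open>H\<close> to the front, so the product rule yields three
    equal copies, which cancel the factor 1/3.\<close>
  moreover have "F \<bullet> mixed_cofactor F H = 2 * (H \<bullet> cofactor F)" for H
    by (simp add: mixed_cofactor_commute[of F H] inner_mixed_cofactor_swap[of F H]
        cofactor_def)
  ultimately show ?thesis
    by (simp add: det_eq_inner_cofactor[abs_def])
qed

section \<open>Gradient and second derivative of the energy\<close>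

lemma gradient_eqI:
  assumes "GDERIV f x :> D"
  shows "gradient f x = D"
  unfolding gradient_def
proof (rule the_equality)
  show "GDERIV f x :> D" by (fact assms)
next
  fix E assume "GDERIV f x :> E"
  then have "(\<lambda>h. h \<bullet> E) = (\<lambda>h. h \<bullet> D)"
    using assms by (auto simp: gderiv_def intro: has_derivative_unique)
  then show "E = D"
    by (metis vector_eq_ldot)
qed

lemma GDERIV_NHCG_energy:
  fixes F :: "real^3^3"
  assumes "det F > 0"
  shows "GDERIV (NHCG_energy M) F :>
    F + (2 * (M/4 - 1/6) * det F - (1 + 2 * (M/4 - 1/6)) / det F) *\<^sub>R cofactor F"
  unfolding gderiv_def NHCG_energy_def[abs_def] power2_norm_eq_inner
  using assms
  by (auto intro!: derivative_eq_intros det_has_derivative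
      simp: fun_eq_iff inner_add_right inner_commute field_simps)

lemma gradient_NHCG_energy_has_derivative:
  fixes F :: "real^3^3" and M :: real
  assumes "det F > 0"
  defines "c \<equiv> M/4 - 1/6"
  shows "(gradient (NHCG_energy M) has_derivative
    (\<lambda>H. H + (2 * c * det F - (1 + 2 * c) / det F) *\<^sub>R mixed_cofactor F H
           + ((2 * c + (1 + 2 * c) / (det F)\<^sup>2) * (H \<bullet> cofactor F)) *\<^sub>R cofactor F)) (at F)"
\<comment> \<open>The closed form of the gradient is known only where \<open>det\<close> is
  positive. That set is open, so the derivative of the closed form at \<open>F\<close> is also that
  of \<open>gradient\<close>.\<close>
proof (rule has_derivative_transform_within_open)
  show "((\<lambda>F. F + (2 * c * det F - (1 + 2 * c) / det F) *\<^sub>R cofactor F) has_derivative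
    (\<lambda>H. H + (2 * c * det F - (1 + 2 * c) / det F) *\<^sub>R mixed_cofactor F H
           + ((2 * c + (1 + 2 * c) / (det F)\<^sup>2) * (H \<bullet> cofactor F)) *\<^sub>R cofactor F)) (at F)"
  proof -
    have "((\<lambda>F. 2 * c * det F - (1 + 2 * c) / det F) has_derivative
        (\<lambda>H. (2 * c + (1 + 2 * c) / (det F)\<^sup>2) * (H \<bullet> cofactor F))) (at F)"
      using assms(1)
      by (auto intro!: derivative_eq_intros det_has_derivative
          simp: fun_eq_iff field_simps power2_eq_square)
    from has_derivative_add[OF has_derivative_ident
        has_derivative_scaleR[OF this cofactor_has_derivative]]
    show ?thesis by (simp add: add.assoc)
  qed
  have "continuous_on UNIV (det :: real^3^3 \<Rightarrow> real)"
    by (meson continuous_at_imp_continuous_on det_has_derivative has_derivative_continuous)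
  then show "open {F :: real^3^3. det F > 0}"
    by (intro open_Collect_less) auto
qed (use assms in \<open>auto simp: gradient_eqI[OF GDERIV_NHCG_energy] c_def\<close>)

lemma norm_transpose: "norm (transpose H) = norm (H :: real^3^3)"
  by (simp add: norm_eq_sqrt_inner inner_vec_def transpose_def sum_3)

lemma second_derivative_NHCG_energy_scaled_mat_1:
  fixes l M :: real
  assumes "l > 0"
  defines "c \<equiv> M/4 - 1/6"
  shows "second_derivative (NHCG_energy M) (l *\<^sub>R mat 1) H \<bullet> H =
    H \<bullet> H - (2 * c * l^4 - (1 + 2 * c) / l\<^sup>2) * (transpose H \<bullet> H) + 4 * c * l^4 * (trace H)\<^sup>2"
proof -
  have tr: "mat 1 \<bullet> H = trace H"
    by (simp add: inner_vec_def mat_def trace_def sum_3)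
  \<comment> \<open>In terms of the scalar factor g of the cofactor in the gradient,
    \<open>A\<close> is g(l^3) l and \<open>B\<close> is g'(l^3) l^4. Both contribute to the trace
    term, where the parts in 1/l^2 cancel.\<close>
  define A where "A = 2 * c * l^4 - (1 + 2 * c) / l\<^sup>2"
  define B where "B = 2 * c * l^4 + (1 + 2 * c) / l\<^sup>2"
  have AB: "(2 * c * l^3 - (1 + 2 * c) / l^3) * l = A"
    "(2 * c + (1 + 2 * c) / (l^3)\<^sup>2) * (x * l\<^sup>2) * l\<^sup>2 = B * x" for x
    using assms(1) by (simp_all add: A_def B_def field_simps eval_nat_numeral)
  have "second_derivative (NHCG_energy M) (l *\<^sub>R mat 1) H =
    H + (2 * c * l^3 - (1 + 2 * c) / l^3) *\<^sub>R l *\<^sub>R (trace H *\<^sub>R mat 1 - transpose H)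
      + ((2 * c + (1 + 2 * c) / (l^3)\<^sup>2) * (H \<bullet> l\<^sup>2 *\<^sub>R mat 1)) *\<^sub>R l\<^sup>2 *\<^sub>R mat 1"
    unfolding second_derivative_def c_def
    by (subst frechet_derivative_at[OF gradient_NHCG_energy_has_derivative, symmetric])
      (use assms(1) in \<open>simp_all only: det_scaled_mat_1 cofactor_scaled_mat_1
        mixed_cofactor_scaled_mat_1 zero_less_power\<close>)
  also have "\<dots> = H + A *\<^sub>R (trace H *\<^sub>R mat 1 - transpose H) + (B * trace H) *\<^sub>R mat 1"
    by (simp only: scaleR_scaleR inner_scaleR_right inner_commute[of H "mat 1"] tr AB
        mult.commute[of "l\<^sup>2" "trace H"])
  also have "\<dots> \<bullet> H = H \<bullet> H - A * (transpose H \<bullet> H) + (A + B) * (trace H)\<^sup>2"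
    by (simp add: inner_add_left inner_diff_left tr algebra_simps power2_eq_square)
  also have "A + B = 4 * c * l^4"
    by (simp add: A_def B_def)
  finally show ?thesis by (simp only: A_def)
qed

section \<open>Nonnegativity of the quadratic form and stability\<close>

text \<open>Transposition is a Frobenius isometry, so Cauchy-Schwarz gives sufficiency, the trace
  term being nonnegative. For necessity, trace-free test matrices remove that term.\<close>

lemma inner_transpose_form_nonneg_iff:
  fixes k p :: real
  assumes "p \<ge> 0"
  shows "(\<forall>H :: real^3^3. H \<bullet> H - k * (transpose H \<bullet> H) + p * (trace H)\<^sup>2 \<ge> 0) \<longleftrightarrow> \<bar>k\<bar> \<le> 1"
proof
  assume form: "\<forall>H :: real^3^3. H \<bullet> H - k * (transpose H \<bullet> H) + p * (trace H)\<^sup>2 \<ge> 0"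
  \<comment> \<open>\<open>E 1\<close> is symmetric and forces \<open>k \<le> 1\<close>;
    \<open>E (-1)\<close> is antisymmetric and forces \<open>k \<ge> -1\<close>.\<close>
  define E :: "real \<Rightarrow> real^3^3" where
    "E s = vector [vector [0, 1, 0], vector [s, 0, 0], vector [0, 0, 0]]" for s
  have "E s \<bullet> E s - k * (transpose (E s) \<bullet> E s) + p * (trace (E s))\<^sup>2 = 1 + s\<^sup>2 - 2 * k * s" for s
    by (simp add: E_def inner_vec_def transpose_def trace_def sum_3 power2_eq_square)
  then show "\<bar>k\<bar> \<le> 1"
    using form[rule_format, of "E 1"] form[rule_format, of "E (-1)"] by simp
next
  assume k: "\<bar>k\<bar> \<le> 1"
  show "\<forall>H :: real^3^3. H \<bullet> H - k * (transpose H \<bullet> H) + p * (trace H)\<^sup>2 \<ge> 0"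
  proof
    fix H :: "real^3^3"
    have "\<bar>transpose H \<bullet> H\<bar> \<le> H \<bullet> H"
      using Cauchy_Schwarz_ineq2[of "transpose H" H]
      by (simp add: norm_transpose flip: power2_norm_eq_inner power2_eq_square)
    then have "\<bar>k\<bar> * \<bar>transpose H \<bullet> H\<bar> \<le> 1 * (H \<bullet> H)"
      using k by (intro mult_mono) auto
    then have "k * (transpose H \<bullet> H) \<le> H \<bullet> H"
      by (simp flip: abs_mult)
    then show "H \<bullet> H - k * (transpose H \<bullet> H) + p * (trace H)\<^sup>2 \<ge> 0"
      using assms by simp
  qed
qed

lemma energetically_stable_scaled_mat_1_iff:
  assumes "M > 2/3" "l > 0"
  shows "energetically_stable (NHCG_energy M) (l *\<^sub>R mat 1) \<longleftrightarrow>
    1 \<le> l \<and> (2 - 3 * M) * l^6 + 6 * l\<^sup>2 + 4 + 3 * M \<ge> 0"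
proof -
  define c where "c = M/4 - 1/6"
  have c: "c > 0" using assms by (simp add: c_def)
  define k where "k = 2 * c * l^4 - (1 + 2 * c) / l\<^sup>2"
  have k: "k * l\<^sup>2 = 2 * c * l^6 - (1 + 2 * c)"
    using assms by (simp add: k_def field_simps eval_nat_numeral)
  have "energetically_stable (NHCG_energy M) (l *\<^sub>R mat 1) \<longleftrightarrow> \<bar>k\<bar> \<le> 1"
    using inner_transpose_form_nonneg_iff[of "4 * c * l^4" k] c assms(2)
    by (simp add: energetically_stable_def k_def c_def
        second_derivative_NHCG_energy_scaled_mat_1)
  also have "\<dots> \<longleftrightarrow> - l\<^sup>2 \<le> k * l\<^sup>2 \<and> k * l\<^sup>2 \<le> l\<^sup>2"
    using mult_le_cancel_right_pos[of "l\<^sup>2" "-1" k] mult_le_cancel_right_pos[of "l\<^sup>2" k 1] assms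
    by auto
  \<comment> \<open>The inequality reads 2c(l^6 - 1) + (l^2 - 1) \<ge> 0, and both summands have the
    sign of l - 1.\<close>
  also have "- l\<^sup>2 \<le> k * l\<^sup>2 \<longleftrightarrow> 1 \<le> l"
  proof
    assume "1 \<le> l"
    then have "l^6 \<ge> 1" "l\<^sup>2 \<ge> 1" by simp_all
    moreover from this have "2 * c * l^6 \<ge> 2 * c * 1"
      using c by (intro mult_left_mono) auto
    ultimately show "- l\<^sup>2 \<le> k * l\<^sup>2" by (simp add: k)
  next
    assume *: "- l\<^sup>2 \<le> k * l\<^sup>2"
    show "1 \<le> l"
    proof (rule ccontr)
      assume "\<not> 1 \<le> l"
      then have "l^6 < 1" "l\<^sup>2 < 1" using assms by (simp_all add: power_less_one_iff)
      moreover from this have "2 * c * l^6 < 2 * c * 1"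
        using c by (intro mult_strict_left_mono) auto
      ultimately show False using * by (simp add: k)
    qed
  qed
  also have "k * l\<^sup>2 \<le> l\<^sup>2 \<longleftrightarrow> (2 - 3 * M) * l^6 + 6 * l\<^sup>2 + 4 + 3 * M \<ge> 0"
  proof -
    \<comment> \<open>The factor 6 comes from 12c = 3M - 2.\<close>
    have "(2 - 3 * M) * l^6 + 6 * l\<^sup>2 + 4 + 3 * M = 6 * (l\<^sup>2 - k * l\<^sup>2)"
      unfolding k by (simp add: c_def field_simps)
    then show ?thesis by (simp only:) simp
  qed
  finally show ?thesis .
qed

section \<open>The critical stretch\<close>

text \<open>Division by l^6 leaves a strictly decreasing function \<open>q\<close> compared with the
  constant 3M - 2, so the polynomial changes sign exactly at its positive root.\<close>

lemma critical_stretch_polynomial_nonneg_iff: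
  assumes "M > 2/3" "is_critical_stretch M L" "l > 0"
  shows "(2 - 3 * M) * l^6 + 6 * l\<^sup>2 + 4 + 3 * M \<ge> 0 \<longleftrightarrow> l \<le> L"
proof -
  define q where "q x = 6 / x^4 + (4 + 3 * M) / x^6" for x :: real
  have mono: "q y < q x" if "0 < x" "x < y" for x y
    unfolding q_def using that assms(1)
    by (intro add_strict_mono divide_strict_left_mono mult_pos_pos power_strict_mono) auto
  have split: "(2 - 3 * M) * x^6 + 6 * x\<^sup>2 + 4 + 3 * M = x^6 * (q x - (3 * M - 2))"
    if "x > 0" for x
    using that by (simp add: q_def field_simps eval_nat_numeral)
  have L: "L > 0" "q L = 3 * M - 2"
    using assms(2) split[of L] by (auto simp: is_critical_stretch_def)
  have "(2 - 3 * M) * l^6 + 6 * l\<^sup>2 + 4 + 3 * M \<ge> 0 \<longleftrightarrow> q L \<le> q l"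
    using assms(3) L(2) by (simp add: split zero_le_mult_iff)
  also have "\<dots> \<longleftrightarrow> l \<le> L"
    using mono[of l L] mono[of L l] L(1) assms(3) by (cases l L rule: linorder_cases) auto
  finally show ?thesis .
qed

lemma ex1_critical_stretch:
  assumes "M > 2/3"
  shows "\<exists>!l. is_critical_stretch M l"
proof -
  define P where "P l = (2 - 3 * M) * l^6 + 6 * l\<^sup>2 + 4 + 3 * M" for l :: real
  define a where "a = 3 * M - 2"
  \<comment> \<open>\<open>y\<close> is the square of the right endpoint for the intermediate value
    theorem. From \<open>a * y = 2 * a + 6\<close> and \<open>y \<ge> 1\<close>, the value of
    \<open>P\<close> there is at most a + 6 - 2ay = -3a - 6.\<close>
  define y where "y = 2 + 6 / a"
  have a: "a > 0" "a * y = 2 * a + 6" and y: "y \<ge> 1"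
    using assms by (auto simp: a_def y_def field_simps)
  define b where "b = sqrt y"
  have b2: "b\<^sup>2 = y" and b0: "b \<ge> 0"
    using y by (auto simp: b_def)
  have "b^6 = y^3"
    using power_mult[of b 2 3] by (simp add: b2)
  then have "P b = 6 * y + a + 6 - (a * y) * (y * y)"
    by (simp add: P_def b2 a_def algebra_simps power3_eq_cube)
  also have "\<dots> \<le> 6 * y + a + 6 - (2 * a + 6) * y"
    using a y by (simp add: mult_left_mono)
  also have "\<dots> \<le> 0"
    using a by (simp add: algebra_simps)
  finally have b: "b \<ge> 0" "P b \<le> 0"
    using b0 by auto
  have "continuous_on {0..b} P"
    unfolding P_def by (intro continuous_intros)
  moreover have "P 0 > 0"
    using assms by (simp add: P_def)
  ultimately obtain l where l: "0 \<le> l" "P l = 0"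
    using IVT2'[of P b 0 0] b by auto
  then have "l \<noteq> 0" using \<open>P 0 > 0\<close> by auto
  with l have "is_critical_stretch M l"
    by (simp add: is_critical_stretch_def P_def)
  \<comment> \<open>The polynomial vanishes at both roots, so the sign criterion bounds each by the
    other.\<close>
  moreover have "l' = l" if "is_critical_stretch M l'" for l'
    using critical_stretch_polynomial_nonneg_iff[OF assms that, of l]
      critical_stretch_polynomial_nonneg_iff[OF assms \<open>is_critical_stretch M l\<close>, of l']
      that \<open>is_critical_stretch M l\<close>
    by (simp add: is_critical_stretch_def)
  ultimately show ?thesis by blast
qed

theorem mainTheorem8:
  fixes M :: real
  assumes "M > 2/3"
  shows "(\<exists>!l. is_critical_stretch M l) \<and>
    (\<forall>l>0. energetically_stable (NHCG_energy M) (l *\<^sub>R mat 1) \<longleftrightarrow>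
             1 \<le> l \<and> l \<le> critical_stretch M)"
proof -
  have "is_critical_stretch M (critical_stretch M)"
    unfolding critical_stretch_def by (rule theI'[OF ex1_critical_stretch[OF assms]])
  then show ?thesis
    using ex1_critical_stretch[OF assms] assms
    by (simp add: energetically_stable_scaled_mat_1_iff critical_stretch_polynomial_nonneg_iff)
qed

end
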